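(* Let $n,c$ be positive integers, $b\in\{1,2,\dots,n-1\}$, and $k=c\cdot n+b$. Then $c+n-1\le F(k,n)\le c+n$.
   Context: Clear Mastermind with $n\ge 1$ positions and $k\ge 1$ codes: write $[k]=\{1,\dots,k\}$. A codemaker fixes a secret answer $y=(y_1,\dots,y_n)\in[k]^n$. In each round the codebreaker submits a guess $x\in[k]^n$ (any string, chosen adaptively from previous guesses and feedback) and receives feedback $\pi(x,y)\in\{\mathrm{G},\mathrm{Y},\mathrm{B}\}^n$ defined as follows: for every position $i$ with $x_i=y_i$, $\pi_i=\mathrm{G}$. Let $M$ be the multiset $\{y_i : x_i\ne y_i\}$ of answer codes at non-G positions. Then scan the non-G positions $j$ in increasing order: if $x_j$ currently occurs in $M$, set $\pi_j=\mathrm{Y}$ and remove one copy of $x_j$ from $M$; otherwise set $\pi_j=\mathrm{B}$. The codebreaker finds the answer in $m$ rounds if her $m$-th guess equals $y$. $F(k,n)$ is the least $m$ such that the codebreaker has a strategy that, for every answer $y\in[k]^n$, makes a guess equal to $y$ within the first $m$ rounds. *)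

theory Defs
  imports Main "HOL-Library.Multiset"
begin

text \<open>Green, Yellow and Black are the letters G, Y and B of the feedback.\<close>

datatype colour = Green | Yellow | Black

definition codes :: "nat \<Rightarrow> nat \<Rightarrow> nat list set" where
  "codes k n = {x. length x = n \<and> set x \<subseteq> {1..k}}"

definition unmatched :: "nat list \<Rightarrow> nat list \<Rightarrow> nat multiset" where
  "unmatched x y = mset (map snd (filter (\<lambda>(a, b). a \<noteq> b) (zip x y)))"

text \<open>The scan from left to right; \<open>M\<close> holds the answer codes at non-green positions
  that have not been consumed by an earlier yellow.\<close>

fun scan :: "nat multiset \<Rightarrow> (nat \<times> nat) list \<Rightarrow> colour list" where
  "scan M [] = []"
| "scan M ((a, b) # ps) =
     (if a = b then Green # scan M ps
      else if a \<in># M then Yellow # scan (M - {#a#}) ps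
      else Black # scan M ps)"

definition feedback :: "nat list \<Rightarrow> nat list \<Rightarrow> colour list" where
  "feedback x y = scan (unmatched x y) (zip x y)"

text \<open>A strategy maps the history of past guesses and their feedback to the next guess.\<close>

type_synonym history = "(nat list \<times> colour list) list"
type_synonym strategy = "history \<Rightarrow> nat list"

definition valid_strategy :: "nat \<Rightarrow> nat \<Rightarrow> strategy \<Rightarrow> bool" where
  "valid_strategy k n s \<longleftrightarrow> (\<forall>h. s h \<in> codes k n)"

fun play :: "strategy \<Rightarrow> nat list \<Rightarrow> nat \<Rightarrow> history" where
  "play s y 0 = []"
| "play s y (Suc m) =
     (let h = play s y m; x = s h in h @ [(x, feedback x y)])"

text \<open>The guess in round \<open>j + 1\<close> is \<open>s (play s y j)\<close>, so the first \<open>m\<close> rounds are \<open>j < m\<close>.\<close>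

definition finds_within :: "strategy \<Rightarrow> nat list \<Rightarrow> nat \<Rightarrow> bool" where
  "finds_within s y m \<longleftrightarrow> (\<exists>j<m. s (play s y j) = y)"

definition solvable_within :: "nat \<Rightarrow> nat \<Rightarrow> nat \<Rightarrow> bool" where
  "solvable_within k n m \<longleftrightarrow>
     (\<exists>s. valid_strategy k n s \<and> (\<forall>y\<in>codes k n. finds_within s y m))"

definition F :: "nat \<Rightarrow> nat \<Rightarrow> nat" where
  "F k n = (LEAST m. solvable_within k n m)"

text \<open>The minimum is over a nonempty set: guessing all strings one after the other succeeds.\<close>

lemma length_play [simp]: "length (play s y m) = m"
  by (induction m) (auto simp: Let_def)

lemma ex_solvable_within:
  assumes "k \<ge> 1"
  shows "\<exists>m. solvable_within k n m"
proof -
  have "finite (codes k n)"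
    unfolding codes_def
    by (rule rev_finite_subset[OF finite_lists_length_eq[of "{1..k}" n]]) auto
  then obtain L where L: "set L = codes k n"
    using finite_list by blast
  have one: "replicate n 1 \<in> codes k n"
    using assms by (auto simp: codes_def)
  define s :: strategy where
    "s h = (if length h < length L then L ! length h else replicate n 1)" for h
  have "valid_strategy k n s"
    using L one by (auto simp: valid_strategy_def s_def dest: nth_mem)
  moreover have "finds_within s y (length L)" if "y \<in> codes k n" for y
  proof -
    from that L obtain j where "j < length L" "L ! j = y"
      by (metis in_set_conv_nth)
    then show ?thesis
      by (auto simp: finds_within_def s_def intro!: exI[of _ j])
  qed
  ultimately show ?thesis
    unfolding solvable_within_def by blast
qed

end

theory Submission
  imports Defs "HOL-Combinatorics.Cycles"
begin

text \<open>
  Upper bound: \<open>c + 1\<close> guesses with distinct entries test every code, so the set \<open>D\<close> of codes of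
  the answer becomes known. Constant guesses locate all codes of \<open>D\<close> in \<open>max 1 (card D)\<close> rounds,
  which is enough if \<open>card D < n\<close> or if some code was green. Otherwise the answer is a permutation
  of \<open>D\<close> and some \<open>a \<in> D\<close> is known not to sit at some position \<open>r\<close>. Guessing \<open>a\<close> everywhere except
  at \<open>r\<close>, and another \<open>e \<in> D\<close> at \<open>r\<close>, locates \<open>a\<close> and either locates \<open>e\<close> as well or excludes
  \<open>e\<close> from \<open>r\<close>; so the process continues and saves one round.

  Lower bound: the codemaker answers the first \<open>c - 1\<close> guesses entirely in black, and then only
  uses permutations of \<open>n\<close> fresh codes. Against permutations the feedback carries no more
  information than the set of green positions. The codemaker keeps a nonempty block of positions
  in which no guess has been green; each position of the block loses at most one of its possible
  codes per round, so \<open>n - 1\<close> rounds never suffice.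
\<close>

section \<open>What green and black letters of the feedback reveal\<close>

lemma length_scan [simp]: "length (scan M ps) = length ps"
  by (induction M ps rule: scan.induct) auto

lemma scan_green_iff:
  "i < length ps \<Longrightarrow> scan M ps ! i = Green \<longleftrightarrow> fst (ps ! i) = snd (ps ! i)"
  by (induction M ps arbitrary: i rule: scan.induct) (auto simp: nth_Cons split: nat.splits)

lemma feedback_green_iff:
  assumes "length y = length x" "i < length x"
  shows "feedback x y ! i = Green \<longleftrightarrow> x ! i = y ! i"
  using assms by (simp add: feedback_def scan_green_iff)

text \<open>Distinct guess entries make the removals harmless: an earlier yellow takes away a copy
  of a different code, so the presence of a later guess code in \<open>M\<close> does not
  change.\<close>

lemma scan_black_iff:
  assumes "i < length ps" "distinct (map fst ps)" "fst (ps ! i) \<noteq> snd (ps ! i)"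
  shows "scan M ps ! i = Black \<longleftrightarrow> fst (ps ! i) \<notin># M"
  using assms
proof (induction M ps arbitrary: i rule: scan.induct)
  case (2 M a b ps)
  show ?case
  proof (cases i)
    case 0
    with 2 show ?thesis by auto
  next
    case (Suc j)
    have j: "j < length ps" using 2 Suc by auto
    have ne: "fst (ps ! j) \<noteq> a"
      using 2(5) nth_mem[OF j] by (auto intro: rev_image_eqI)
    have "fst (ps ! j) \<in># M - {#a#} \<longleftrightarrow> fst (ps ! j) \<in># M"
      using ne by (simp add: in_diff_count)
    with 2 Suc j show ?thesis by auto
  qed
qed auto

lemma set_mset_unmatched:
  "set_mset (unmatched x y) = {b. \<exists>a. (a, b) \<in> set (zip x y) \<and> a \<noteq> b}"
  by (force simp: unmatched_def)

text \<open>If a code of a repetition-free guess sits elsewhere in the answer, the guess has a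
  different entry there, so this copy survives in \<open>unmatched\<close>. Such a guess therefore
  tests all its codes for membership at once.\<close>

lemma feedback_black_iff:
  assumes "length y = length x" "i < length x" "distinct x"
  shows "feedback x y ! i = Black \<longleftrightarrow> x ! i \<notin> set y"
proof (cases "x ! i = y ! i")
  case True
  then have "feedback x y ! i = Green" using feedback_green_iff assms by auto
  then show ?thesis using True assms by (metis colour.distinct(3) nth_mem)
next
  case False
  have "x ! i \<in># unmatched x y \<longleftrightarrow> x ! i \<in> set y"
  proof
    show "x ! i \<in> set y" if "x ! i \<in># unmatched x y"
      using that by (auto simp: set_mset_unmatched dest: set_zip_rightD)
  next
    assume "x ! i \<in> set y"
    then obtain j where j: "j < length y" "y ! j = x ! i" by (auto simp: in_set_conv_nth)
    then have "x ! j \<noteq> x ! i"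
      using False assms by (metis nth_eq_iff_index_eq)
    then show "x ! i \<in># unmatched x y"
      using j assms unfolding set_mset_unmatched set_zip mem_Collect_eq by (metis min.idem)
  qed
  then show ?thesis
    using False assms by (simp add: feedback_def scan_black_iff)
qed

lemma feedback_all_black:
  assumes "length y = length x" "set x \<inter> set y = {}"
  shows "feedback x y = replicate (length x) Black"
proof -
  have scan: "scan M ps = replicate (length ps) Black"
    if "\<And>a b. (a, b) \<in> set ps \<Longrightarrow> a \<noteq> b \<and> a \<notin># M" for M ps
    using that by (induction ps) fastforce+
  have "a \<noteq> b \<and> a \<notin># unmatched x y" if "(a, b) \<in> set (zip x y)" for a b
    using that assms by (fastforce simp: set_mset_unmatched dest: set_zip_leftD set_zip_rightD)
  then show ?thesis
    using assms(1) unfolding feedback_def by (subst scan) auto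
qed

lemma feedback_cong_mset:
  assumes "length x = n" "length y = n" "length z = n" "mset y = mset z"
    and green: "\<And>i. i < n \<Longrightarrow> x ! i = y ! i \<longleftrightarrow> x ! i = z ! i"
  shows "feedback x y = feedback x z"
proof -
  have xy: "length x = length y" and yz: "length y = length z"
    and g: "\<forall>i<length x. x ! i = y ! i \<longleftrightarrow> x ! i = z ! i"
    using assms by auto
  \<comment> \<open>Subtraction-free form of the fact that \<open>mset y - unmatched x y\<close> and
    \<open>mset z - unmatched x z\<close> are both the multiset of green codes.\<close>
  from xy yz g have "mset y + unmatched x z = mset z + unmatched x y"
    by (induction x y z rule: list_induct3) (auto simp: unmatched_def All_less_Suc2)
  then have "unmatched x z = unmatched x y" using assms by simp
  moreover from xy yz g have "scan M (zip x y) = scan M (zip x z)" for M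
    by (induction x y z arbitrary: M rule: list_induct3) (auto simp: All_less_Suc2)
  ultimately show ?thesis by (simp add: feedback_def)
qed

section \<open>The game as a recursion on sets of candidate answers\<close>

text \<open>\<open>Y\<close> holds the answers consistent with the feedback so far and not yet
  guessed, \<open>m\<close> counts the rounds left. Feedback that cannot occur leads to the empty
  set, which is solvable as soon as \<open>codes k n\<close> is nonempty.\<close>

fun solvable :: "nat \<Rightarrow> nat \<Rightarrow> nat \<Rightarrow> nat list set \<Rightarrow> bool" where
  "solvable k n 0 Y \<longleftrightarrow> Y = {}"
| "solvable k n (Suc m) Y \<longleftrightarrow>
     (\<exists>x\<in>codes k n. \<forall>f. solvable k n m {y \<in> Y. y \<noteq> x \<and> feedback x y = f})"

lemma solvable_mono_set: "solvable k n m Y \<Longrightarrow> Z \<subseteq> Y \<Longrightarrow> solvable k n m Z"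
proof (induction m arbitrary: Y Z)
  case (Suc m)
  then obtain x where x: "x \<in> codes k n"
    "\<And>f. solvable k n m {y \<in> Y. y \<noteq> x \<and> feedback x y = f}" by auto
  have "solvable k n m {y \<in> Z. y \<noteq> x \<and> feedback x y = f}" for f
    by (rule Suc.IH[OF x(2)[of f]]) (use Suc.prems in auto)
  with x show ?case by auto
qed auto

lemma solvable_le_one:
  assumes "Y \<subseteq> codes k n" "\<And>y z. y \<in> Y \<Longrightarrow> z \<in> Y \<Longrightarrow> y = z" "k \<ge> 1"
  shows "solvable k n (Suc m) Y"
proof -
  have empty: "solvable k n m {}" for m
    using assms(3) by (induction m) (auto simp: codes_def intro!: exI[of _ "replicate n 1"])
  show ?thesis
  proof (cases "Y = {}")
    case True
    then show ?thesis using empty by blast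
  next
    case False
    then obtain y where "y \<in> Y" by blast
    moreover have "{z \<in> Y. z \<noteq> y \<and> feedback y z = f} = {}" for f
      using assms(2)[OF \<open>y \<in> Y\<close>] by blast
    ultimately show ?thesis
      unfolding solvable.simps using assms(1) empty by (intro bexI[of _ y] allI) (simp_all only:, blast)
  qed
qed

text \<open>\<open>play\<close> appends rounds at the end of the history, while
  \<open>solvable\<close> peels off the first one. The continuation after the first round is
  \<open>s\<close> with that round put in front of every history.\<close>

lemma play_Suc_shift:
  "play s y (Suc m) =
     (s [], feedback (s []) y) # play (\<lambda>h. s ((s [], feedback (s []) y) # h)) y m"
  by (induction m) (auto simp: Let_def)

lemma finds_within_Suc:
  "finds_within s y (Suc m) \<longleftrightarrow>
     s [] = y \<or> finds_within (\<lambda>h. s ((s [], feedback (s []) y) # h)) y m"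
  unfolding finds_within_def Ex_less_Suc2 play_Suc_shift by simp

lemma solvable_if_strategy:
  "valid_strategy k n s \<Longrightarrow> \<forall>y\<in>Y. finds_within s y m \<Longrightarrow> solvable k n m Y"
proof (induction m arbitrary: s Y)
  case 0
  then show ?case unfolding finds_within_def by simp
next
  case (Suc m)
  have "solvable k n m {y \<in> Y. y \<noteq> s [] \<and> feedback (s []) y = f}" for f
  proof (rule Suc.IH[where s = "\<lambda>h. s ((s [], f) # h)"])
    show "valid_strategy k n (\<lambda>h. s ((s [], f) # h))"
      using Suc.prems(1) unfolding valid_strategy_def by blast
    show "\<forall>y\<in>{y \<in> Y. y \<noteq> s [] \<and> feedback (s []) y = f}.
        finds_within (\<lambda>h. s ((s [], f) # h)) y m"
    proof
      fix y assume y: "y \<in> {y \<in> Y. y \<noteq> s [] \<and> feedback (s []) y = f}"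
      then have "finds_within s y (Suc m)" using Suc.prems(2) by blast
      with y show "finds_within (\<lambda>h. s ((s [], f) # h)) y m"
        by (simp only: finds_within_Suc mem_Collect_eq) metis
    qed
  qed
  moreover have "s [] \<in> codes k n" using Suc.prems(1) unfolding valid_strategy_def by blast
  ultimately show ?case unfolding solvable.simps by (intro bexI allI)
qed

lemma strategy_if_solvable:
  assumes "k \<ge> 1" "solvable k n m Y"
  obtains s where "valid_strategy k n s" "\<And>y. y \<in> Y \<Longrightarrow> finds_within s y m"
proof -
  have "\<exists>s. valid_strategy k n s \<and> (\<forall>y\<in>Y. finds_within s y m)"
    using assms(2)
  proof (induction m arbitrary: Y)
    case 0
    have "replicate n 1 \<in> codes k n" using assms(1) by (auto simp: codes_def)
    then have "valid_strategy k n (\<lambda>h. replicate n 1)" by (simp add: valid_strategy_def)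
    with 0 show ?case by auto
  next
    case (Suc m)
    then obtain x where x: "x \<in> codes k n"
      "\<And>f. solvable k n m {y \<in> Y. y \<noteq> x \<and> feedback x y = f}" by auto
    then have "\<forall>f. \<exists>s. valid_strategy k n s \<and>
        (\<forall>y\<in>{y \<in> Y. y \<noteq> x \<and> feedback x y = f}. finds_within s y m)"
      using Suc.IH by blast
    then obtain t where t: "\<And>f. valid_strategy k n (t f)"
      "\<And>y. y \<in> Y \<Longrightarrow> y \<noteq> x \<Longrightarrow> finds_within (t (feedback x y)) y m"
      by (auto dest!: choice)
    \<comment> \<open>The first feedback selects the strategy for all later rounds, which then sees
      only those rounds.\<close>
    define s where "s h = (case h of [] \<Rightarrow> x | (_, f) # h' \<Rightarrow> t f h')" for h
    have "valid_strategy k n s"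
      using x(1) t(1) by (auto simp: valid_strategy_def s_def split: list.splits)
    moreover have "finds_within s y (Suc m)" if "y \<in> Y" for y
      using t(2)[OF that] by (cases "y = x") (simp_all add: finds_within_Suc s_def)
    ultimately show ?case by blast
  qed
  then show thesis using that by blast
qed

lemma solvable_within_iff:
  assumes "k \<ge> 1"
  shows "solvable_within k n m \<longleftrightarrow> solvable k n m (codes k n)"
proof
  show "solvable k n m (codes k n)" if "solvable_within k n m"
    using that solvable_if_strategy unfolding solvable_within_def by blast
  show "solvable_within k n m" if "solvable k n m (codes k n)"
    by (rule strategy_if_solvable[OF assms that]) (auto simp: solvable_within_def)
qed

text \<open>Guesses fixed in advance can be treated as one batch, with \<open>\<phi>\<close>
  recording an arbitrary feedback to each of them.\<close>

lemma solvable_prefix: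
  assumes "set gs \<subseteq> codes k n"
    and "\<And>\<phi>. solvable k n m {y \<in> Y. \<forall>x\<in>set gs. feedback x y = \<phi> x}"
  shows "solvable k n (length gs + m) Y"
  using assms
proof (induction gs arbitrary: Y)
  case (Cons x gs)
  have "solvable k n (length gs + m) {y \<in> Y. y \<noteq> x \<and> feedback x y = f}" for f
  proof (rule Cons.IH)
    show "solvable k n m {y \<in> {y \<in> Y. y \<noteq> x \<and> feedback x y = f}. \<forall>x\<in>set gs. feedback x y = \<phi> x}"
      for \<phi>
      by (rule solvable_mono_set[OF Cons.prems(2)[of "\<phi>(x := f)"]]) auto
  qed (use Cons.prems in auto)
  with Cons.prems(1) show ?case by auto
qed auto

section \<open>Upper bound: locating the codes of the answer\<close>

text \<open>The codes outside \<open>D\<close> are already located; only the arrangement of codes of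
  \<open>D\<close> is still open.\<close>

definition agree_off :: "nat set \<Rightarrow> nat list set \<Rightarrow> bool" where
  "agree_off D Y \<longleftrightarrow>
     (\<forall>y\<in>Y. \<forall>z\<in>Y. \<forall>i<length y. y ! i \<notin> D \<longrightarrow> z ! i = y ! i)"

text \<open>A constant guess is green exactly where its code sits, so each round locates one code of
  \<open>D\<close>. The last code needs no such guess, as it fills all remaining positions; this
  leaves the final round for the answer itself.\<close>

lemma solvable_agree_off:
  assumes "D \<subseteq> {1..k}" "card D \<le> Suc m" "Y \<subseteq> codes k n" "agree_off D Y" "k \<ge> 1"
  shows "solvable k n (Suc m) Y"
  using assms
proof (induction m arbitrary: D Y)
  case 0
  have fin: "finite D" using 0 finite_subset by blast
  show ?case
  proof (rule solvable_le_one)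
    fix y z assume yz: "y \<in> Y" "z \<in> Y"
    have len: "length y = n" "length z = n" using yz 0 by (auto simp: codes_def)
    show "y = z"
    proof (rule nth_equalityI)
      fix i assume i: "i < length y"
      show "y ! i = z ! i"
      proof (cases "y ! i \<in> D \<and> z ! i \<in> D")
        case True
        then show ?thesis using 0(2) fin by (meson card_le_Suc0_iff_eq One_nat_def)
      next
        case False
        then show ?thesis using 0(4) yz i len by (metis agree_off_def)
      qed
    qed (use len in auto)
  qed (use 0 in auto)
next
  case (Suc m)
  have fin: "finite D" using Suc finite_subset by blast
  \<comment> \<open>If \<open>D\<close> is already empty, the code \<open>1\<close> merely fills the
    round.\<close>
  define a where "a = (if D = {} then 1 else (SOME a. a \<in> D))"
  have a: "a \<in> {1..k}" "D \<noteq> {} \<Longrightarrow> a \<in> D"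
    using Suc.prems(1,5) by (auto simp: a_def some_in_eq dest!: subsetD intro: someI_ex)
  let ?x = "replicate n a"
  have "solvable k n (Suc m) {y \<in> Y. y \<noteq> ?x \<and> feedback ?x y = f}" (is "solvable k n _ ?Z") for f
  proof (rule Suc.IH[of "D - {a}"])
    show "card (D - {a}) \<le> Suc m"
      using Suc.prems(2) a(2) fin by (cases "D = {}") auto
    show "agree_off (D - {a}) ?Z"
      unfolding agree_off_def
    proof (intro ballI allI impI)
      fix y z i assume h: "y \<in> ?Z" "z \<in> ?Z" "i < length y" "y ! i \<notin> D - {a}"
      have len: "length y = n" "length z = n" using h Suc.prems by (auto simp: codes_def)
      show "z ! i = y ! i"
      proof (cases "y ! i = a")
        case True
        then have "feedback ?x y ! i = Green" using feedback_green_iff[of y ?x i] len h by auto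
        then have "feedback ?x z ! i = Green" using h by auto
        then show ?thesis using feedback_green_iff[of z ?x i] len h True by auto
      next
        case False
        then show ?thesis using h Suc.prems(4) by (auto simp: agree_off_def)
      qed
    qed
  qed (use Suc.prems in auto)
  moreover have "?x \<in> codes k n" using a by (auto simp: codes_def)
  ultimately show ?case unfolding solvable.simps(2)[of k n "Suc m"] by blast
qed

lemma feedback_eqD:
  assumes "feedback x y = feedback x z" "length y = length x" "length z = length x" "i < length x"
  shows "x ! i = y ! i \<longleftrightarrow> x ! i = z ! i"
  using feedback_green_iff[OF assms(2,4)] feedback_green_iff[OF assms(3,4)] assms(1) by simp

text \<open>This is one round less than \<open>card D\<close>. The saving comes from a position
  \<open>r\<close> that holds a code of \<open>D\<close> other than \<open>a\<close>. Each round
  passes this knowledge on to a new code, until that code is found at \<open>r\<close> or only two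
  codes are left.\<close>

lemma solvable_permutation_exclusion:
  assumes "D \<subseteq> {1..k}" "card D = Suc (Suc m)" "Y \<subseteq> codes k n" "agree_off D Y"
    and "\<And>y. y \<in> Y \<Longrightarrow> distinct y" "a \<in> D" "r < n"
    and "\<And>y. y \<in> Y \<Longrightarrow> y ! r \<in> D - {a}" "k \<ge> 1"
  shows "solvable k n (Suc m) Y"
  using assms
proof (induction m arbitrary: D Y a)
  case 0
  then have fin: "finite D" by (metis card.infinite nat.distinct(1))
  have "card (D - {a}) = Suc 0" using fin 0 by simp
  then obtain e where e: "D - {a} = {e}" by (auto simp: card_Suc_eq)
  have D: "D = {a, e}" using e 0 by auto
  show ?case
  proof (rule solvable_le_one)
    fix y z assume yz: "y \<in> Y" "z \<in> Y"
    have len: "length y = n" "length z = n" using yz 0 by (auto simp: codes_def)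
    have re: "y ! r = e" "z ! r = e" using 0 yz e by blast+
    show "y = z"
    proof (rule nth_equalityI)
      fix i assume i: "i < length y"
      show "y ! i = z ! i"
      proof (cases "y ! i \<in> D \<and> z ! i \<in> D")
        case True
        have "y ! i = e \<longleftrightarrow> i = r" "z ! i = e \<longleftrightarrow> i = r"
          using re i len 0(5,7) yz nth_eq_iff_index_eq[of y i r] nth_eq_iff_index_eq[of z i r] by auto
        then show ?thesis using True D by auto
      next
        case False
        then show ?thesis using 0(4) yz i len by (metis agree_off_def)
      qed
    qed (use len in auto)
  qed (use 0 in auto)
next
  case (Suc m)
  then have fin: "finite D" by (metis card.infinite nat.distinct(1))
  have "card (D - {a}) = Suc (Suc m)" using fin Suc.prems by simp
  then obtain e where e: "e \<in> D" "e \<noteq> a" by (auto simp: card_Suc_eq)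
  \<comment> \<open>No candidate has \<open>a\<close> at \<open>r\<close>, so the guess still
    locates \<open>a\<close> and can test \<open>e\<close> at \<open>r\<close> for free. Since
    answers are distinct, a green \<open>e\<close> is located completely and \<open>D\<close> loses
    two codes; otherwise \<open>e\<close> takes over the role of \<open>a\<close>.\<close>
  define x where "x = (replicate n a)[r := e]"
  have xr: "x ! r = e" and xi: "\<And>i. i < n \<Longrightarrow> i \<noteq> r \<Longrightarrow> x ! i = a"
    and lx: "length x = n"
    using Suc.prems by (auto simp: x_def)
  have xc: "x \<in> codes k n"
  proof -
    have "set x \<subseteq> {a, e}" unfolding x_def by (rule set_update_subsetI) auto
    then show ?thesis using lx Suc.prems(1,6) e by (auto simp: codes_def)
  qed
  have "solvable k n (Suc m) {y \<in> Y. y \<noteq> x \<and> feedback x y = f}" (is "solvable k n _ ?Z") for f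
  proof -
    have len: "length y = n" if "y \<in> ?Z" for y using that Suc.prems by (auto simp: codes_def)
    have green: "x ! i = y ! i \<longleftrightarrow> x ! i = z ! i" if "y \<in> ?Z" "z \<in> ?Z" "i < n" for y z i
      using feedback_eqD[of x y z i] that len lx by auto
    have off_a: "z ! i = a" if "y \<in> ?Z" "z \<in> ?Z" "i < n" "y ! i = a" for y z i
    proof -
      have "i \<noteq> r" using that Suc.prems(8)[of y] by auto
      then show ?thesis using green[OF that(1-3)] xi that by auto
    qed
    have off: "agree_off (D - {a}) ?Z"
      unfolding agree_off_def
    proof (intro ballI allI impI)
      fix y z i assume h: "y \<in> ?Z" "z \<in> ?Z" "i < length y" "y ! i \<notin> D - {a}"
      have i: "i < n" using h len by auto
      show "z ! i = y ! i"
      proof (cases "y ! i = a")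
        case True
        then show ?thesis using off_a[OF h(1,2) i] by simp
      next
        case False
        then show ?thesis using h Suc.prems(4) by (auto simp: agree_off_def)
      qed
    qed
    show ?thesis
    proof (cases "\<exists>y\<in>?Z. y ! r = e")
      case True
      have all_e: "z ! r = e" if "z \<in> ?Z" for z
      proof -
        from True obtain y where y: "y \<in> ?Z" "y ! r = e" by blast
        show ?thesis using green[OF y(1) that Suc.prems(7)] y(2) unfolding xr by simp
      qed
      show ?thesis
      proof (rule solvable_agree_off[of "D - {a} - {e}"])
        show "card (D - {a} - {e}) \<le> Suc m" using fin e Suc.prems by simp
        show "agree_off (D - {a} - {e}) ?Z"
          unfolding agree_off_def
        proof (intro ballI allI impI)
          fix y z i assume h: "y \<in> ?Z" "z \<in> ?Z" "i < length y" "y ! i \<notin> D - {a} - {e}"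
          show "z ! i = y ! i"
          proof (cases "y ! i = e")
            case True
            then have "i = r"
              using all_e[OF h(1)] Suc.prems(5)[of y] h(1,3) Suc.prems(7) len[OF h(1)]
                nth_eq_iff_index_eq[of y i r] by auto
            then show ?thesis using all_e h by auto
          next
            case False
            then have "y ! i \<notin> D - {a}" using h(4) by simp
            then show ?thesis using off[unfolded agree_off_def, rule_format, OF h(1-3)] by simp
          qed
        qed
      qed (use Suc.prems in auto)
    next
      case False
      show ?thesis
      proof (rule Suc.IH[of "D - {a}" _ e])
        show "card (D - {a}) = Suc (Suc m)" by fact
        show "agree_off (D - {a}) ?Z" by (fact off)
        show "y ! r \<in> D - {a} - {e}" if "y \<in> ?Z" for y
          using that False Suc.prems(8)[of y] by auto
      qed (use Suc.prems e in auto)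
    qed
  qed
  with xc show ?case unfolding solvable.simps(2)[of k n "Suc m"] by blast
qed

text \<open>A spare round is gained in each of three ways: \<open>D\<close> has fewer than
  \<open>n\<close> codes, or the answer is a permutation with \<open>a\<close> already located at
  \<open>r\<close>, or it is one with \<open>a\<close> excluded from \<open>r\<close>.\<close>

lemma solvable_same_set:
  assumes "n \<ge> 2" "k \<ge> 1" "Y \<subseteq> codes k n" "\<And>y. y \<in> Y \<Longrightarrow> set y = D"
    and "D \<noteq> {} \<Longrightarrow> a \<in> D" "r < n"
    and green: "\<And>y z. y \<in> Y \<Longrightarrow> z \<in> Y \<Longrightarrow> y ! r = a \<longleftrightarrow> z ! r = a"
  shows "solvable k n (n - 1) Y"
proof (cases "Y = {}")
  case True
  then show ?thesis using solvable_le_one[of "{}" k n "n - 2"] assms(1,2)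
    by (simp add: numeral_2_eq_2 Suc_diff_Suc)
next
  case False
  then obtain y0 where y0: "y0 \<in> Y" by blast
  have len: "length y = n" if "y \<in> Y" for y using that assms(3) by (auto simp: codes_def)
  have D: "D \<subseteq> {1..k}" "card D \<le> n"
    using y0 assms(3,4) len[OF y0] card_length[of y0] by (auto simp: codes_def)
  have fin: "finite D" using D finite_subset by blast
  have mem: "y ! i \<in> D" if "y \<in> Y" "i < n" for y i using that assms(4) len nth_mem by metis
  have aD: "a \<in> D" using mem[OF y0] assms(5,6) by auto
  have off: "agree_off D Y" unfolding agree_off_def using mem len by metis
  have n1: "n - 1 = Suc (n - 2)" using assms(1) by simp
  consider (small) "card D \<le> n - 1" | (green) "card D = n" "y0 ! r = a" | (yellow) "card D = n" "y0 ! r \<noteq> a"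
    using D(2) by linarith
  then show ?thesis
  proof cases
    case small
    then show ?thesis unfolding n1 by (intro solvable_agree_off[of D] D assms(2,3) off) simp
  next
    case yellow
    have "distinct y" if "y \<in> Y" for y
      using that yellow assms(4) len by (metis card_distinct)
    moreover have "y ! r \<in> D - {a}" if "y \<in> Y" for y
      using green[OF that y0] yellow mem[OF that assms(6)] by simp
    ultimately show ?thesis unfolding n1
      using yellow assms(1)
      by (intro solvable_permutation_exclusion[of D _ _ _ _ a r] D assms(2,3,6) off aD) auto
  next
    case green
    have dist: "distinct y" if "y \<in> Y" for y
      using that green assms(4) len by (metis card_distinct)
    have r: "y ! r = a" if "y \<in> Y" for y using assms(7)[OF that y0] green by simp
    have "agree_off (D - {a}) Y"
      unfolding agree_off_def
    proof (intro ballI allI impI)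
      fix y z i assume h: "y \<in> Y" "z \<in> Y" "i < length y" "y ! i \<notin> D - {a}"
      have "y ! i = a" using h mem[OF h(1)] len by auto
      then have "i = r" using r[OF h(1)] dist[OF h(1)] h(3) assms(6) len[OF h(1)]
        by (metis nth_eq_iff_index_eq)
      then show "z ! i = y ! i" using r h by simp
    qed
    then show ?thesis unfolding n1
      using green aD fin D(1) assms(1)
      by (intro solvable_agree_off[of "D - {a}"] assms(2,3)) auto
  qed
qed

lemma solvable_upper:
  assumes "n \<ge> 2" "n \<le> k" "k \<le> l * n"
  shows "solvable k n (l + (n - 1)) (codes k n)"
proof -
  \<comment> \<open>Consecutive windows of \<open>n\<close> codes, read cyclically modulo
    \<open>k\<close> and shifted by one because codes start at \<open>1\<close>. Entries are
    distinct as \<open>n \<le> k\<close>, and \<open>l\<close> windows reach every code as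
    \<open>k \<le> l * n\<close>.\<close>
  define g where "g j = map (\<lambda>i. (j * n + i) mod k + 1) [0..<n]" for j
  define gs where "gs = map g [0..<l]"
  have k: "k \<ge> 1" using assms by simp
  have g_codes: "g j \<in> codes k n" for j
    using k by (auto simp: g_def codes_def Suc_le_eq)
  have g_dist: "distinct (g j)" for j
  proof -
    have "inj_on (\<lambda>i. (j * n + i) mod k) {0..<n}"
    proof (rule inj_onI)
      fix i i' assume "i \<in> {0..<n}" "i' \<in> {0..<n}" and eq: "(j * n + i) mod k = (j * n + i') mod k"
      then have "i < k" "i' < k" using assms(2) by auto
      moreover have "i mod k = i' mod k" using eq by (simp add: mod_eq_nat1E nat_mod_eq_iff)
      ultimately show "i = i'" by simp
    qed
    then show ?thesis by (auto simp: g_def distinct_map inj_on_def)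
  qed
  have cover: "\<exists>j<l. \<exists>i<n. g j ! i = a" if "a \<in> {1..k}" for a
  proof (intro exI conjI)
    have "a - 1 < l * n" using that assms(3) by auto
    then show "(a - 1) div n < l" by (simp add: less_mult_imp_div_less)
    show "(a - 1) mod n < n" using assms(1) by simp
    then show "g ((a - 1) div n) ! ((a - 1) mod n) = a"
      using that by (auto simp: g_def)
  qed
  have "solvable k n (n - 1) {y \<in> codes k n. \<forall>x\<in>set gs. feedback x y = \<phi> x}"
    (is "solvable k n _ ?Y") for \<phi>
  proof -
    have fb: "feedback (g j) y = feedback (g j) z" if "y \<in> ?Y" "z \<in> ?Y" "j < l" for y z j
      using that by (auto simp: gs_def)
    have len: "length y = n" if "y \<in> ?Y" for y using that by (auto simp: codes_def)
    have lg: "length (g j) = n" for j by (simp add: g_def)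
    have sub: "set y \<subseteq> set z" if yz: "y \<in> ?Y" "z \<in> ?Y" for y z
    proof
      fix a assume a: "a \<in> set y"
      then have "a \<in> {1..k}" using yz by (auto simp: codes_def)
      then obtain j i where ji: "j < l" "i < n" "g j ! i = a" using cover by blast
      show "a \<in> set z"
        using feedback_black_iff[of y "g j" i] feedback_black_iff[of z "g j" i]
          fb[OF yz ji(1)] ji a len yz lg g_dist by auto
    qed
    show ?thesis
    proof (cases "?Y = {}")
      case True
      show ?thesis unfolding True using solvable_le_one[of "{}" k n "n - 2"] assms(1) k
        by (simp add: numeral_2_eq_2 Suc_diff_Suc)
    next
      case False
      then obtain y0 where y0: "y0 \<in> ?Y" by blast
      \<comment> \<open>Any code of the common set would serve as \<open>a\<close>. Some window has
        guessed it at a position \<open>i\<close>, so all candidates agree on whether it sits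
        there.\<close>
      have m: "y0 ! 0 \<in> set y0" using len[OF y0] assms(1) by simp
      moreover have "set y0 \<subseteq> {1..k}" using y0 by (auto simp: codes_def)
      ultimately obtain j i where ji: "j < l" "i < n" "g j ! i = y0 ! 0" using cover by blast
      show ?thesis
      proof (rule solvable_same_set[of n k ?Y "set y0" "y0 ! 0" i])
        show "set y = set y0" if "y \<in> ?Y" for y using sub[OF that y0] sub[OF y0 that] by blast
        show "y ! i = y0 ! 0 \<longleftrightarrow> z ! i = y0 ! 0" if "y \<in> ?Y" "z \<in> ?Y" for y z
        proof -
          have "g j ! i = y ! i \<longleftrightarrow> g j ! i = z ! i"
            by (rule feedback_eqD[OF fb[OF that ji(1)]]) (simp_all only: len that lg ji(2))
          then show ?thesis unfolding ji(3) by (simp only: eq_commute)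
        qed
      qed (use assms k m ji in auto)
    qed
  qed
  then have "solvable k n (length gs + (n - 1)) (codes k n)"
    by (intro solvable_prefix) (use g_codes in \<open>auto simp: gs_def\<close>)
  then show ?thesis by (simp add: gs_def)
qed

section \<open>Cycles and sinks of a relation\<close>

text \<open>If the next vertex of the walk was visited before, the path is cut back to that
  visit.\<close>

lemma rtrancl_distinct_path:
  assumes "(a, b) \<in> E\<^sup>*"
  obtains xs where "distinct xs" "xs \<noteq> []" "hd xs = a" "last xs = b"
    "successively (\<lambda>p q. (p, q) \<in> E) xs"
proof -
  have "\<exists>xs. distinct xs \<and> xs \<noteq> [] \<and> hd xs = a \<and> last xs = b \<and>
      successively (\<lambda>p q. (p, q) \<in> E) xs"
    using assms
  proof (induction rule: rtrancl_induct)
    case base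
    show ?case by (rule exI[of _ "[a]"]) simp
  next
    case (step b c)
    then obtain xs where xs: "distinct xs" "xs \<noteq> []" "hd xs = a" "last xs = b"
      "successively (\<lambda>p q. (p, q) \<in> E) xs" by blast
    show ?case
    proof (cases "c \<in> set xs")
      case False
      then show ?thesis using xs step(2)
        by (intro exI[of _ "xs @ [c]"]) (auto simp: successively_append_iff)
    next
      case True
      then obtain ys zs where "xs = ys @ c # zs" by (meson split_list)
      then show ?thesis using xs
        by (intro exI[of _ "ys @ [c]"])
          (auto simp: successively_append_iff successively_Cons hd_append)
    qed
  qed
  then show thesis using that by blast
qed

text \<open>The edge from a predecessor \<open>b\<close> back to \<open>a\<close> closes a simple
  path from \<open>a\<close> to \<open>b\<close> into a cycle, and \<open>\<tau>\<close> moves its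
  vertices one step along it. For \<open>b = a\<close> this is the identity, with a loop at
  \<open>a\<close>.\<close>

lemma trancl_cycle_permutation:
  assumes "(a, a) \<in> E\<^sup>+" "E \<subseteq> P \<times> P"
  obtains \<tau> where "\<tau> permutes P" "(a, \<tau> a) \<in> E" "\<And>p. \<tau> p = p \<or> (p, \<tau> p) \<in> E"
proof -
  from assms(1) obtain b where b: "(a, b) \<in> E\<^sup>*" "(b, a) \<in> E" by (meson tranclD2)
  obtain xs where xs: "distinct xs" "xs \<noteq> []" "hd xs = a" "last xs = b"
    "successively (\<lambda>p q. (p, q) \<in> E) xs" using rtrancl_distinct_path[OF b(1)] .
  define \<tau> where "\<tau> = cycle_of_list xs"
  have rot: "map \<tau> xs = rotate1 xs"
    using cyclic_rotation[OF xs(1), of 1] by (simp add: \<tau>_def)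
  have edge: "(p, \<tau> p) \<in> E" if "p \<in> set xs" for p
  proof -
    from that obtain i where i: "i < length xs" "xs ! i = p" by (auto simp: in_set_conv_nth)
    have "\<tau> p = rotate1 xs ! i" using i by (metis rot nth_map)
    then have \<tau>p: "\<tau> p = xs ! (Suc i mod length xs)" using i nth_rotate1 by metis
    show ?thesis
    proof (cases "Suc i < length xs")
      case True
      then show ?thesis using xs(5) i \<tau>p by (auto simp: successively_conv_nth)
    next
      case False
      then have "i = length xs - 1" "Suc i = length xs" using i by auto
      then show ?thesis using xs b i \<tau>p by (auto simp: hd_conv_nth last_conv_nth)
    qed
  qed
  have "set xs \<subseteq> P" using edge assms(2) by blast
  then have "\<tau> permutes P" using cycle_permutes[of xs] permutes_subset by (auto simp: \<tau>_def)
  moreover have "(a, \<tau> a) \<in> E" using edge xs by (metis hd_in_set)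
  moreover have "\<tau> p = p \<or> (p, \<tau> p) \<in> E" for p
    using edge id_outside_supp[of p xs] by (cases "p \<in> set xs") (auto simp: \<tau>_def)
  ultimately show thesis using that by blast
qed

text \<open>Restricted to the finite set \<open>G\<close>, the relation \<open>E\<^sup>+\<close> is
  a strict order, so it has a sink; the converse is taken because \<open>wf\<close> provides minimal
  elements.\<close>

lemma exists_trancl_closed_avoiding:
  assumes "finite G" "G \<noteq> {}" "\<And>g. g \<in> G \<Longrightarrow> (g, g) \<notin> E\<^sup>+"
  obtains g where "g \<in> G" "\<And>h. h \<in> G \<Longrightarrow> (g, h) \<notin> E\<^sup>+"
proof -
  define R where "R = (E\<^sup>+ \<inter> G \<times> G)\<inverse>"
  have tr: "trans R" unfolding R_def by (auto intro!: transI)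
  have "acyclic R"
    unfolding acyclic_def trancl_id[OF tr] using assms(3) by (auto simp: R_def)
  moreover have "finite R" using assms(1) by (auto simp: R_def intro: finite_subset[of _ "G \<times> G"])
  ultimately have "wf R" by (simp add: finite_acyclic_wf)
  then have "\<exists>g\<in>G. \<forall>h. (h, g) \<in> R \<longrightarrow> h \<notin> G"
    using assms(2) unfolding wf_eq_minimal by (metis ex_in_conv)
  then obtain g where g: "g \<in> G" "\<And>h. (h, g) \<in> R \<Longrightarrow> h \<notin> G" by blast
  have "(g, h) \<notin> E\<^sup>+" if "h \<in> G" for h
    using g(2)[of h] g(1) that unfolding R_def by blast
  then show thesis using that g(1) by blast
qed

section \<open>Lower bound: a codemaker avoiding green\<close>

text \<open>Answers are encoded as \<open>permute_list \<sigma> y\<close>: \<open>\<sigma> p\<close>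
  is the position of \<open>y\<close> whose code moves to \<open>p\<close>, and \<open>B p\<close>
  lists the positions it may come from.\<close>

definition block_perms :: "nat list \<Rightarrow> nat set \<Rightarrow> (nat \<Rightarrow> nat set) \<Rightarrow> (nat \<Rightarrow> nat) set" where
  "block_perms y P B = {\<sigma>. \<sigma> permutes P \<and> (\<forall>p\<in>P. \<sigma> p \<in> B p)}"

text \<open>
  After a guess \<open>x\<close> the codemaker picks a permutation \<open>\<sigma>\<close> in the block with as few greens as
  possible and draws an edge from \<open>p\<close> to \<open>q\<close> if the code at \<open>q\<close> may move to \<open>p\<close> without being green
  there. A cycle through a green position would allow a rotation with fewer greens. Hence, if any,
  some green position reaches no green position, and the set of positions it reaches is closed under
  edges: it is the next block, and its positions lose no possible code except the guessed one.
\<close>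

lemma not_solvable_block:
  assumes "distinct y" "length y = n" "P \<subseteq> {..<n}" "P \<noteq> {}"
    and "\<And>p. p \<in> P \<Longrightarrow> B p \<subseteq> P \<and> t < card (B p)"
    and "block_perms y P B \<noteq> {}"
  shows "\<not> solvable k n t ((\<lambda>\<sigma>. permute_list \<sigma> y) ` block_perms y P B)"
  using assms
proof (induction t arbitrary: y P B)
  case 0
  then show ?case by simp
next
  case (Suc t)
  let ?Y = "(\<lambda>\<sigma>. permute_list \<sigma> y) ` block_perms y P B"
  have finP: "finite P" using Suc.prems(3) finite_subset by blast
  have "\<exists>f. \<not> solvable k n t {z \<in> ?Y. z \<noteq> x \<and> feedback x z = f}" if x: "x \<in> codes k n" for x
  proof -
    have lx: "length x = n" using x by (simp add: codes_def)
    let ?G = "\<lambda>\<sigma>. {p \<in> P. x ! p = y ! \<sigma> p}"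
    obtain \<sigma> where \<sigma>: "\<sigma> \<in> block_perms y P B"
      and min: "\<And>\<rho>. \<rho> \<in> block_perms y P B \<Longrightarrow> card (?G \<sigma>) \<le> card (?G \<rho>)"
      using ex_has_least_nat[of "\<lambda>\<sigma>. \<sigma> \<in> block_perms y P B" _ "\<lambda>\<sigma>. card (?G \<sigma>)"] Suc.prems(6)
      by blast
    have \<sigma>P: "\<sigma> permutes P" and \<sigma>B: "\<And>p. p \<in> P \<Longrightarrow> \<sigma> p \<in> B p"
      using \<sigma> by (auto simp: block_perms_def)
    have \<sigma>n: "\<sigma> permutes {..<n}" using \<sigma>P Suc.prems(3) permutes_subset by blast
    \<comment> \<open>The next block is described relative to the minimising answer
      \<open>y'\<close> instead of \<open>y\<close>, so that the identity is admissible in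
      it.\<close>
    define y' where "y' = permute_list \<sigma> y"
    have y': "distinct y'" "length y' = n"
      using Suc.prems(1,2) \<sigma>n by (auto simp: y'_def)
    have y'_nth: "y' ! p = y ! \<sigma> p" if "p < n" for p
      using that Suc.prems(2) \<sigma>n by (simp add: y'_def permute_list_nth)
    \<comment> \<open>In particular \<open>p\<close> in \<open>P\<close> carries a loop exactly if
      it is not green for \<open>\<sigma>\<close>.\<close>
    define E where "E = {(p, q). p \<in> P \<and> q \<in> P \<and> \<sigma> q \<in> B p \<and> y ! \<sigma> q \<noteq> x ! p}"
    have EP: "E \<subseteq> P \<times> P" by (auto simp: E_def)
    have acyc: "(g, g) \<notin> E\<^sup>+" if g: "g \<in> ?G \<sigma>" for g
    proof
      assume "(g, g) \<in> E\<^sup>+"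
      then obtain \<tau> where \<tau>: "\<tau> permutes P" "(g, \<tau> g) \<in> E" "\<And>p. \<tau> p = p \<or> (p, \<tau> p) \<in> E"
        using trancl_cycle_permutation[OF _ EP] by blast
      have "(\<sigma> \<circ> \<tau>) p \<in> B p" if "p \<in> P" for p
        using \<tau>(3)[of p] \<sigma>B[OF that] by (auto simp: E_def)
      then have "\<sigma> \<circ> \<tau> \<in> block_perms y P B"
        using permutes_compose[OF \<tau>(1) \<sigma>P] by (simp add: block_perms_def)
      then have "card (?G \<sigma>) \<le> card (?G (\<sigma> \<circ> \<tau>))" by (rule min)
      \<comment> \<open>By the choice of \<open>E\<close>, no position is green after moving along
        an edge, so \<open>\<tau>\<close> creates no green and destroys the one at
        \<open>g\<close>.\<close>
      moreover have "?G (\<sigma> \<circ> \<tau>) \<subset> ?G \<sigma>"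
      proof (rule psubsetI)
        show "?G (\<sigma> \<circ> \<tau>) \<subseteq> ?G \<sigma>"
        proof
          fix p assume "p \<in> ?G (\<sigma> \<circ> \<tau>)"
          then show "p \<in> ?G \<sigma>" using \<tau>(3)[of p] by (auto simp: E_def)
        qed
        have "g \<notin> ?G (\<sigma> \<circ> \<tau>)" using \<tau>(2) by (auto simp: E_def)
        then show "?G (\<sigma> \<circ> \<tau>) \<noteq> ?G \<sigma>" using g by blast
      qed
      with finP have "card (?G (\<sigma> \<circ> \<tau>)) < card (?G \<sigma>)"
        by (intro psubset_card_mono) auto
      ultimately show False by simp
    qed
    \<comment> \<open>\<open>\<sigma>\<close> maps the successors of \<open>p\<close> bijectively
      onto \<open>B p\<close> without the positions of the guessed code, and there is at most one of
      these because \<open>y\<close> is distinct.\<close>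
    have card_E: "t < card (E `` {p})" if p: "p \<in> P" for p
    proof -
      have Bp: "B p \<subseteq> P" "Suc t < card (B p)" using Suc.prems(5)[OF p] by auto
      have finB: "finite (B p)" using Bp finP finite_subset by blast
      have inj: "inj_on \<sigma> (E `` {p})" using \<sigma>P by (meson permutes_inj_on)
      have img: "\<sigma> ` (E `` {p}) = B p - {q \<in> P. y ! q = x ! p}"
      proof (intro equalityI subsetI)
        fix q assume q: "q \<in> B p - {q \<in> P. y ! q = x ! p}"
        then obtain q' where "q' \<in> P" "q = \<sigma> q'"
          using Bp permutes_image[OF \<sigma>P] by blast
        then show "q \<in> \<sigma> ` (E `` {p})" using q p Bp by (auto simp: E_def)
      qed (auto simp: E_def)
      have "card {q \<in> P. y ! q = x ! p} \<le> Suc 0"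
        using finP Suc.prems(1-3)
        by (auto simp: card_le_Suc0_iff_eq subset_iff) (metis nth_eq_iff_index_eq)
      moreover have "card (B p) - card {q \<in> P. y ! q = x ! p} \<le> card (B p - {q \<in> P. y ! q = x ! p})"
        using finP by (intro diff_card_le_card_Diff) auto
      ultimately show ?thesis using card_image[OF inj] Bp(2) unfolding img by linarith
    qed
    obtain A where A: "A \<subseteq> P" "A \<noteq> {}" "A \<inter> ?G \<sigma> = {}" "\<And>p. p \<in> A \<Longrightarrow> E `` {p} \<subseteq> A"
    proof (cases "?G \<sigma> = {}")
      case True
      then show ?thesis using that[of P] Suc.prems(4) EP by blast
    next
      case False
      then obtain g where g: "g \<in> ?G \<sigma>" "\<And>h. h \<in> ?G \<sigma> \<Longrightarrow> (g, h) \<notin> E\<^sup>+"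
        using exists_trancl_closed_avoiding[OF _ False acyc] finP by auto
      show ?thesis
      proof (rule that[of "E\<^sup>+ `` {g}"])
        show "E\<^sup>+ `` {g} \<subseteq> P" using trancl_subset_Sigma[OF EP] by blast
        have "E `` {g} \<noteq> {}" using card_E[of g] g(1) by (metis (no_types, lifting) card.empty mem_Collect_eq not_less_zero)
        then show "E\<^sup>+ `` {g} \<noteq> {}" by blast
        show "E\<^sup>+ `` {g} \<inter> ?G \<sigma> = {}" using g(2) by blast
        show "E `` {p} \<subseteq> E\<^sup>+ `` {g}" if "p \<in> E\<^sup>+ `` {g}" for p
          using that by (auto intro: trancl_into_trancl)
      qed
    qed
    have An: "A \<subseteq> {..<n}" using A(1) Suc.prems(3) by blast
    let ?B' = "\<lambda>p. E `` {p}"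
    \<comment> \<open>This is where loops matter: every position of \<open>A\<close> has one, since
      \<open>A\<close> contains no green position.\<close>
    have "id \<in> block_perms y' A ?B'"
      using A(1,3) \<sigma>B by (auto simp: block_perms_def permutes_id E_def)
    then have "\<not> solvable k n t ((\<lambda>\<tau>. permute_list \<tau> y') ` block_perms y' A ?B')"
      by (intro Suc.IH y' An A(2)) (use A card_E in auto)
    moreover have "(\<lambda>\<tau>. permute_list \<tau> y') ` block_perms y' A ?B'
        \<subseteq> {z \<in> ?Y. z \<noteq> x \<and> feedback x z = feedback x y'}"
    proof (rule image_subsetI)
      fix \<tau> assume "\<tau> \<in> block_perms y' A ?B'"
      then have \<tau>A: "\<tau> permutes A" and \<tau>E: "\<And>p. p \<in> A \<Longrightarrow> (p, \<tau> p) \<in> E"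
        by (auto simp: block_perms_def)
      have \<tau>P: "\<tau> permutes P" and \<tau>n: "\<tau> permutes {..<n}"
        using \<tau>A A(1) An permutes_subset by blast+
      have \<tau>_out: "\<tau> p = p" if "p \<notin> A" for p using \<tau>A that by (simp add: permutes_not_in)
      let ?z = "permute_list \<tau> y'"
      have z_nth: "?z ! p = y' ! \<tau> p" if "p < n" for p
        using that y' \<tau>n by (simp add: permute_list_nth)
      have "(\<sigma> \<circ> \<tau>) p \<in> B p" if "p \<in> P" for p
        using \<tau>E[of p] \<tau>_out[of p] \<sigma>B[OF that] by (cases "p \<in> A") (auto simp: E_def)
      then have "\<sigma> \<circ> \<tau> \<in> block_perms y P B"
        using permutes_compose[OF \<tau>P \<sigma>P] by (simp add: block_perms_def)
      moreover have "?z = permute_list (\<sigma> \<circ> \<tau>) y"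
        using permute_list_compose[of \<tau> y \<sigma>] \<tau>n Suc.prems(2) by (simp add: y'_def)
      ultimately have zY: "?z \<in> ?Y" by blast
      have ngreen: "?z ! p \<noteq> x ! p" if "p \<in> A" for p
      proof -
        have "p < n" "\<tau> p < n" using that An permutes_in_image[OF \<tau>A, of p] by auto
        then show ?thesis using \<tau>E[OF that] z_nth y'_nth by (auto simp: E_def)
      qed
      have "?z \<noteq> x" using ngreen A(2) by blast
      \<comment> \<open>Positions outside \<open>A\<close> are unchanged, and inside
        \<open>A\<close> nothing is green before or after the rearrangement.\<close>
      moreover have "feedback x ?z = feedback x y'"
      proof (rule feedback_cong_mset[where n = n])
        show "mset ?z = mset y'" using \<tau>n y' by simp
        show "x ! i = ?z ! i \<longleftrightarrow> x ! i = y' ! i" if "i < n" for i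
        proof (cases "i \<in> A")
          case True
          then have "x ! i \<noteq> y' ! i" using A(1,3) that y'_nth by auto
          then show ?thesis using ngreen[OF True] by auto
        next
          case False
          then show ?thesis using z_nth[OF that] \<tau>_out by simp
        qed
      qed (use lx y' in auto)
      ultimately show "?z \<in> {z \<in> ?Y. z \<noteq> x \<and> feedback x z = feedback x y'}"
        using zY by blast
    qed
    ultimately show ?thesis using solvable_mono_set by blast
  qed
  then show ?case by auto
qed

text \<open>Each all-black reply costs at most \<open>n\<close> codes of \<open>T\<close>. After
  \<open>r\<close> of them at least \<open>n\<close> codes are left, and the permutations of
  \<open>n\<close> of these outlast another \<open>n - 1\<close> rounds.\<close>

lemma not_solvable_fresh:
  assumes "n \<ge> 1" "finite T" "card T \<ge> Suc r * n"
    and "{y. length y = n \<and> set y \<subseteq> T} \<subseteq> Y"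
  shows "\<not> solvable k n (r + (n - 1)) Y"
  using assms(2-)
proof (induction r arbitrary: T Y)
  case 0
  obtain S where S: "S \<subseteq> T" "card S = n" using 0(2) obtain_subset_with_card_n[of n T] by auto
  then have "finite S" using 0(1) finite_subset by blast
  then obtain y where y: "set y = S" "distinct y" using finite_distinct_list by blast
  have len: "length y = n" using y S distinct_card by metis
  \<comment> \<open>Initially the block is everything, and each position has \<open>n\<close>
    possible codes, one more than the rounds left.\<close>
  let ?B = "\<lambda>_. {..<n}"
  have "\<not> solvable k n (n - 1) ((\<lambda>\<sigma>. permute_list \<sigma> y) ` block_perms y {..<n} ?B)"
    by (rule not_solvable_block)
      (use y len assms(1) in \<open>auto simp: block_perms_def lessThan_empty_iff intro!: exI[of _ id] permutes_id\<close>)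
  moreover have "(\<lambda>\<sigma>. permute_list \<sigma> y) ` block_perms y {..<n} ?B \<subseteq> Y"
  proof (rule image_subsetI)
    fix \<sigma> assume "\<sigma> \<in> block_perms y {..<n} ?B"
    then have "\<sigma> permutes {..<length y}" by (simp add: block_perms_def len)
    then have "set (permute_list \<sigma> y) = S" using y by simp
    then show "permute_list \<sigma> y \<in> Y" using 0(3) S(1) len by auto
  qed
  ultimately show ?case using solvable_mono_set by auto
next
  case (Suc r)
  have "\<exists>f. \<not> solvable k n (r + (n - 1)) {y \<in> Y. y \<noteq> x \<and> feedback x y = f}"
    if x: "x \<in> codes k n" for x
  proof
    have lx: "length x = n" using x by (simp add: codes_def)
    show "\<not> solvable k n (r + (n - 1)) {y \<in> Y. y \<noteq> x \<and> feedback x y = replicate n Black}"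
    proof (rule Suc.IH)
      have "card (set x) \<le> n" using card_length[of x] lx by simp
      moreover have "card T - card (set x) \<le> card (T - set x)"
        by (simp add: diff_card_le_card_Diff)
      ultimately show "Suc r * n \<le> card (T - set x)" using Suc.prems(2) by simp
      show "{y. length y = n \<and> set y \<subseteq> T - set x}
          \<subseteq> {y \<in> Y. y \<noteq> x \<and> feedback x y = replicate n Black}"
      proof
        fix y assume "y \<in> {y. length y = n \<and> set y \<subseteq> T - set x}"
        then have y: "length y = n" "set y \<subseteq> T" "set x \<inter> set y = {}" by auto
        have "y \<noteq> []" using y assms(1) by auto
        then have "y \<noteq> x" using y(3) by auto
        then show "y \<in> {y \<in> Y. y \<noteq> x \<and> feedback x y = replicate n Black}"
          using y Suc.prems(3) lx feedback_all_black[of y x] by auto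
      qed
    qed (use Suc.prems in auto)
  qed
  then show ?case by auto
qed

theorem theorem3:
  fixes n c b k :: nat
  assumes "n \<ge> 1" and "c \<ge> 1" and "b \<in> {1..n - 1}" and "k = c * n + b"
  shows "c + n - 1 \<le> F k n \<and> F k n \<le> c + n"
proof
  have n: "n \<ge> 2" and k: "k \<ge> 1" "n \<le> k" "k \<le> Suc c * n"
    using assms by (auto intro: trans_le_add1)
  have "solvable_within k n (F k n)"
    unfolding F_def using ex_solvable_within[OF k(1)] by (rule LeastI_ex)
  then obtain s where s: "valid_strategy k n s" "\<And>y. y \<in> codes k n \<Longrightarrow> finds_within s y (F k n)"
    by (auto simp: solvable_within_def)
  show "c + n - 1 \<le> F k n"
  proof (rule ccontr)
    assume "\<not> c + n - 1 \<le> F k n"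
    \<comment> \<open>The truncated subtractions are exact since \<open>c\<close> and
      \<open>n\<close> are positive.\<close>
    then have le: "F k n \<le> (c - 1) + (n - 1)" using assms by linarith
    have "finds_within s y ((c - 1) + (n - 1))" if "y \<in> codes k n" for y
      using s(2)[OF that] le by (auto simp: finds_within_def intro: less_le_trans)
    then have "solvable k n ((c - 1) + (n - 1)) (codes k n)"
      using s(1) by (intro solvable_if_strategy[of _ _ s]) auto
    moreover have "\<not> solvable k n ((c - 1) + (n - 1)) (codes k n)"
      \<comment> \<open>Here \<open>r = c - 1\<close>, so the required number of codes is
        \<open>c * n\<close>, which is at most \<open>k\<close>.\<close>
      by (rule not_solvable_fresh[of n "{1..k}"]) (use assms in \<open>auto simp: codes_def\<close>)
    ultimately show False by blast
  qed
  \<comment> \<open>As \<open>b < n\<close>, all codes fit into \<open>Suc c\<close> windows of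
    length \<open>n\<close>.\<close>
  have "solvable_within k n (Suc c + (n - 1))"
    using solvable_upper[OF n k(2,3)] k(1) solvable_within_iff by simp
  then have "F k n \<le> Suc c + (n - 1)" unfolding F_def by (rule Least_le)
  then show "F k n \<le> c + n" using n by simp
qed

end
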